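(* There exist an $s$-$t$ DAG $G=(V,E)$, a flow $X\colon E\to\mathbb N$, and $s$-$t$ paths $P_1,\dots,P_k$ that are the paths of a minimum flow decomposition of $(G,X)$ with weights in $\mathbb N$ (so $k=\mathrm{mfd}_{\mathbb N}(G,X)$), such that the linear system $w_1P_1+\dots+w_kP_k=X$ has two distinct solutions $w\in\mathbb N^k$; in particular the $|E|\times k$ $0/1$ matrix $L$ with $L_{i,j}=1$ if and only if path $P_j$ crosses edge $e_i$ has rank strictly less than $k$.
   Context: An $s$-$t$ DAG is a directed acyclic graph $G=(V,E)$ with a unique source $s$ (no in-edges) and a unique sink $t$ (no out-edges). A flow is a function $X$ on $E$ such that at every node of $V\setminus\{s,t\}$ incoming flow equals outgoing flow. An $s$-$t$ path $P$ is identified with the flow that is $1$ on the edges of $P$ and $0$ elsewhere. A flow decomposition of $(G,X)$ of size $k$ with weights in $\mathbb N$ ($0\in\mathbb N$) is a family of $s$-$t$ paths $P_1,\dots,P_k$ with weights $w_1,\dots,w_k\in\mathbb N$ such that $X=w_1P_1+\dots+w_kP_k$; $\mathrm{mfd}_{\mathbb N}(G,X)$ is the smallest size of such a decomposition, and a flow decomposition of that size is called minimum. *)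

theory Defs
  imports "Graph_Theory.Arc_Walk" "Jordan_Normal_Form.DL_Rank"
begin

definition st_dag :: "('a, 'b) pre_digraph \<Rightarrow> 'a \<Rightarrow> 'a \<Rightarrow> bool" where
  "st_dag G s t \<longleftrightarrow>
     digraph G \<and> acyclic (arcs_ends G) \<and>
     {v \<in> verts G. in_arcs G v = {}} = {s} \<and>
     {v \<in> verts G. out_arcs G v = {}} = {t}"

text \<open>Flows are total functions on the arc type; only their values on \<^term>\<open>arcs G\<close> matter.\<close>

definition is_flow ::
  "('a, 'b) pre_digraph \<Rightarrow> 'a \<Rightarrow> 'a \<Rightarrow> ('b \<Rightarrow> nat) \<Rightarrow> bool" where
  "is_flow G s t X \<longleftrightarrow>
     (\<forall>v \<in> verts G - {s, t}. (\<Sum>e\<in>in_arcs G v. X e) = (\<Sum>e\<in>out_arcs G v. X e))"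

definition path_flow :: "'b awalk \<Rightarrow> 'b \<Rightarrow> nat" where
  "path_flow p e = (if e \<in> set p then 1 else 0)"

definition solves_system ::
  "('a, 'b) pre_digraph \<Rightarrow> ('b \<Rightarrow> nat) \<Rightarrow> 'b awalk list \<Rightarrow> nat list \<Rightarrow> bool" where
  "solves_system G X Ps ws \<longleftrightarrow>
     length ws = length Ps \<and>
     (\<forall>e \<in> arcs G. (\<Sum>j<length Ps. ws ! j * path_flow (Ps ! j) e) = X e)"

definition flow_decomposition ::
  "('a, 'b) pre_digraph \<Rightarrow> 'a \<Rightarrow> 'a \<Rightarrow> ('b \<Rightarrow> nat) \<Rightarrow> 'b awalk list \<Rightarrow> nat list \<Rightarrow> bool" where
  "flow_decomposition G s t X Ps ws \<longleftrightarrow>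
     (\<forall>p \<in> set Ps. pre_digraph.apath G s p t) \<and> solves_system G X Ps ws"

definition mfd_nat :: "('a, 'b) pre_digraph \<Rightarrow> 'a \<Rightarrow> 'a \<Rightarrow> ('b \<Rightarrow> nat) \<Rightarrow> nat" where
  "mfd_nat G s t X = (LEAST k. \<exists>Ps ws. length Ps = k \<and> flow_decomposition G s t X Ps ws)"

definition minimum_flow_decomposition ::
  "('a, 'b) pre_digraph \<Rightarrow> 'a \<Rightarrow> 'a \<Rightarrow> ('b \<Rightarrow> nat) \<Rightarrow> 'b awalk list \<Rightarrow> nat list \<Rightarrow> bool" where
  "minimum_flow_decomposition G s t X Ps ws \<longleftrightarrow>
     flow_decomposition G s t X Ps ws \<and> length Ps = mfd_nat G s t X"

text \<open>The list \<open>es\<close> enumerates the edges and thereby fixes the order of the rows.\<close>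

definition path_matrix :: "'b list \<Rightarrow> 'b awalk list \<Rightarrow> real mat" where
  "path_matrix es Ps =
     mat (length es) (length Ps) (\<lambda>(i, j). if es ! i \<in> set (Ps ! j) then 1 else 0)"

end

theory Submission
  imports Defs "HOL-Library.Code_Binary_Nat"
begin

text \<open>
  If two weightings of the same paths induce the same flow, their difference \<open>d\<close> sums to zero over
  the paths crossing any given arc. Moving along \<open>d\<close> would normally make some weight vanish and so
  save a path; it does not do so here because the weights \<open>1\<close> and \<open>3\<close> of the two paths with
  \<open>d = 2\<close> and \<open>d = -2\<close> skip over \<open>0\<close>. That no other seven paths suffice is a finite search: the
  multisets of weights carried by the arcs are conserved at inner vertices, so one can sweep over
  the vertices while keeping, for every arc of the current cut, only the coarsest grouping of these
  weights that is forced so far.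
\<close>

section \<open>Grouping the weights on a cut\<close>

text \<open>\<open>groups xs M\<close>: the weights \<open>M\<close> can be split into nonempty parts with the sums \<open>xs\<close>. Hence
  \<open>xs\<close> need not list the weights of individual paths, and its length is a lower bound for their number.\<close>

inductive groups :: "nat list \<Rightarrow> nat multiset \<Rightarrow> bool" where
  Nil: "groups [] {#}"
| Cons: "N \<noteq> {#} \<Longrightarrow> groups xs M \<Longrightarrow> groups (\<Sum>\<^sub># N # xs) (N + M)"

inductive_cases groups_NilE: "groups [] M"
inductive_cases groups_ConsE: "groups (x # xs) M"

lemma groups_length_le: "groups xs M \<Longrightarrow> length xs \<le> size M"
proof (induction rule: groups.induct)
  case (Cons N xs M)
  then have "size N \<ge> 1" by (metis One_nat_def Suc_leI nonempty_has_size)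
  with Cons show ?case by simp
qed simp

lemma groups_sum: "groups xs M \<Longrightarrow> sum_list xs = \<Sum>\<^sub># M"
  by (induction rule: groups.induct) auto

lemma groups_append: "groups xs M \<Longrightarrow> groups ys N \<Longrightarrow> groups (xs @ ys) (M + N)"
  by (induction rule: groups.induct) (auto simp: add.assoc intro: groups.intros)

lemma groups_concat:
  "(\<And>e. e \<in> set es \<Longrightarrow> groups (f e) (M e)) \<Longrightarrow>
   groups (concat (map f es)) (\<Sum>e\<leftarrow>es. M e)"
  by (induction es) (auto intro: groups_append groups.Nil)

lemma groups_singleton: "\<Sum>\<^sub># M \<noteq> 0 \<Longrightarrow> groups [\<Sum>\<^sub># M] M"
  using groups.Cons[OF _ groups.Nil, of M] by force

text \<open>All ways to remove a total of \<open>c\<close> from \<open>xs\<close> when at most \<open>b\<close> entries may be cut in two;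
  the second component is what remains.\<close>

fun takes :: "nat \<Rightarrow> nat \<Rightarrow> nat list \<Rightarrow> (nat list \<times> nat list) list" where
  "takes b c [] = (if c = 0 then [([], [])] else [])"
| "takes b c (x # xs) =
     (if x + sum_list xs < c then [] else
      map (\<lambda>(ys, zs). (ys, x # zs)) (takes b c xs) @
      (if x \<le> c then map (\<lambda>(ys, zs). (x # ys, zs)) (takes b (c - x) xs) else []) @
      (if b = 0 then [] else
         concat (map (\<lambda>a. if a \<le> c
           then map (\<lambda>(ys, zs). (a # ys, (x - a) # zs)) (takes (b - 1) (c - a) xs) else [])
         [1..<x])))"

text \<open>The entry \<open>x\<close> stays, is removed whole, or is cut at \<open>a\<close>. These
  rules replace the unfolding of \<open>takes.simps(2)\<close>; the assumption passes the pruning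
  test.\<close>

lemma takes_ConsI:
  assumes "c \<le> x + sum_list xs"
  shows "(ys, zs) \<in> set (takes b c xs) \<Longrightarrow> (ys, x # zs) \<in> set (takes b c (x # xs))"
    and "x \<le> c \<Longrightarrow> (ys, zs) \<in> set (takes b (c - x) xs) \<Longrightarrow>
      (x # ys, zs) \<in> set (takes b c (x # xs))"
    and "b > 0 \<Longrightarrow> 1 \<le> a \<Longrightarrow> a < x \<Longrightarrow> a \<le> c \<Longrightarrow>
      (ys, zs) \<in> set (takes (b - 1) (c - a) xs) \<Longrightarrow>
      (a # ys, (x - a) # zs) \<in> set (takes b c (x # xs))"
proof -
  show "(ys, x # zs) \<in> set (takes b c (x # xs))" if "(ys, zs) \<in> set (takes b c xs)"
    using assms image_eqI[OF refl that, of "\<lambda>(ys, zs). (ys, x # zs)"] by simp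
  show "(x # ys, zs) \<in> set (takes b c (x # xs))"
    if "x \<le> c" "(ys, zs) \<in> set (takes b (c - x) xs)"
    using assms that(1) image_eqI[OF refl that(2), of "\<lambda>(ys, zs). (x # ys, zs)"] by simp
  show "(a # ys, (x - a) # zs) \<in> set (takes b c (x # xs))"
    if "b > 0" "1 \<le> a" "a < x" "a \<le> c" "(ys, zs) \<in> set (takes (b - 1) (c - a) xs)"
  proof -
    let ?f = "\<lambda>a. if a \<le> c
      then map (\<lambda>(ys, zs). (a # ys, (x - a) # zs)) (takes (b - 1) (c - a) xs) else []"
    have "(a # ys, (x - a) # zs) \<in> set (?f a)"
      using that(4) image_eqI[OF refl that(5), of "\<lambda>(ys, zs). (a # ys, (x - a) # zs)"] by simp
    moreover have "a \<in> set [1..<x]" using that(2,3) by simp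
    ultimately have "(a # ys, (x - a) # zs) \<in> set (concat (map ?f [1..<x]))"
      unfolding set_concat set_map by blast
    then show ?thesis using assms that(1) by (simp del: set_concat set_map)
  qed
qed

declare takes.simps(2) [simp del]

text \<open>Each part of the grouping is intersected with \<open>A\<close> and \<open>B\<close>. An
  entry is cut only if its part meets both, and positivity of the weights makes both pieces
  nonzero.\<close>

lemma takes_complete:
  assumes "groups xs (A + B)" "0 \<notin># A + B" "\<Sum>\<^sub># A = c" "size (A + B) \<le> length xs + b"
  shows "\<exists>ys zs. (ys, zs) \<in> set (takes b c xs) \<and> groups ys A \<and> groups zs B"
  using assms
proof (induction xs arbitrary: A B b c)
  case Nil
  then show ?case by (auto elim: groups_NilE intro: groups.Nil)
next
  case (Cons x xs)
  from Cons.prems(1) obtain N M where N: "N \<noteq> {#}" "x = \<Sum>\<^sub># N" "A + B = N + M" "groups xs M"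
    by (auto elim: groups_ConsE)
  \<comment> \<open>Riesz decomposition of the two splittings \<open>A + B = N + M\<close>\<close>
  define NA NB A' B' where defs: "NA = N \<inter># A" "NB = N - A" "A' = A - N" "B' = B - (N - A)"
  have split: "N = NA + NB" "A = NA + A'" "B = NB + B'" "M = A' + B'"
  proof -
    have *: "count N z + count M z = count A z + count B z" for z
      using N(3) by (metis count_union)
    show "N = NA + NB" "A = NA + A'" unfolding defs by (auto intro!: multiset_eqI)
    show "B = NB + B'"
    proof (rule multiset_eqI)
      show "count B z = count (NB + B') z" for z using *[of z] by (simp add: defs)
    qed
    show "M = A' + B'"
    proof (rule multiset_eqI)
      show "count M z = count (A' + B') z" for z using *[of z] by (simp add: defs)
    qed
  qed
  have pos: "0 \<notin># A' + B'" "0 \<notin># NA" "0 \<notin># NB" using Cons.prems(2) split by auto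
  have szN: "size N \<ge> 1" using N(1) by (metis One_nat_def Suc_leI nonempty_has_size)
  have size: "size (A' + B') + size N \<le> Suc (length xs) + b"
    using Cons.prems(4) split by simp
  have ge: "c \<le> x + sum_list xs"
    using groups_sum[OF Cons.prems(1)] Cons.prems(3) by simp
  have sumpos: "\<Sum>\<^sub># K > 0" if "K \<noteq> {#}" "0 \<notin># K" for K :: "nat multiset"
    using that by (metis gr0I multiset_nonemptyE sum_mset_0_iff)
  have x: "x = \<Sum>\<^sub># NA + \<Sum>\<^sub># NB" using N(2) split(1) by simp
  have c: "c = \<Sum>\<^sub># NA + \<Sum>\<^sub># A'" using Cons.prems(3) split(2) by simp
  have IH: "\<exists>ys zs. (ys, zs) \<in> set (takes b' (\<Sum>\<^sub># A') xs) \<and> groups ys A' \<and> groups zs B'"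
    if "size (A' + B') \<le> length xs + b'" for b'
    using Cons.IH[OF _ pos(1) refl that] N(4) split(4) by simp
  consider "NA = {#}" | "NB = {#}" | "NA \<noteq> {#}" "NB \<noteq> {#}" by blast
  then show ?case
  proof cases
    case 1
    from IH[of b] size szN obtain ys zs
      where "(ys, zs) \<in> set (takes b c xs)" "groups ys A'" "groups zs B'"
      using c 1 by auto
    moreover have "groups (x # zs) B" using groups.Cons[of N zs B'] N 1 split \<open>groups zs B'\<close> by simp
    ultimately show ?thesis using takes_ConsI(1)[OF ge] 1 split(2) by (metis add_0)
  next
    case 2
    from IH[of b] size szN obtain ys zs
      where "(ys, zs) \<in> set (takes b (c - x) xs)" "groups ys A'" "groups zs B'"
      using c x 2 by auto
    moreover have "groups (x # ys) A" using groups.Cons[of N ys A'] N 2 split \<open>groups ys A'\<close> by simp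
    moreover have "x \<le> c" using c x 2 by simp
    ultimately show ?thesis using takes_ConsI(2)[OF ge] 2 split(3) by (metis add_0)
  next
    case 3
    define a where "a = \<Sum>\<^sub># NA"
    have a: "1 \<le> a" "a < x" "a \<le> c" "x - a = \<Sum>\<^sub># NB"
      using sumpos[OF 3(1) pos(2)] sumpos[OF 3(2) pos(3)] x c by (auto simp: a_def)
    \<comment> \<open>A cut part holds at least two weights for its one entry, so each cut costs one
      unit of the surplus \<open>b\<close> of weights over entries.\<close>
    have "size NA \<ge> 1" "size NB \<ge> 1"
      using 3 by (simp_all add: Suc_leI nonempty_has_size)
    then have szN2: "size N \<ge> 2" using split(1) by simp
    show ?thesis
    proof (cases "b = 0")
      case True
      then show ?thesis using size szN2 groups_length_le[OF N(4)] split(4) by simp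
    next
      case False
      have "size (A' + B') \<le> length xs + (b - 1)" using size szN2 False by linarith
      from IH[OF this] obtain ys zs
        where *: "(ys, zs) \<in> set (takes (b - 1) (c - a) xs)" "groups ys A'" "groups zs B'"
        using c by (auto simp: a_def)
      have "groups (a # ys) A" "groups ((x - a) # zs) B"
        using groups.Cons[OF 3(1) *(2)] groups.Cons[OF 3(2) *(3)] split a by (simp_all add: a_def)
      moreover have "(a # ys, (x - a) # zs) \<in> set (takes b c (x # xs))"
        using takes_ConsI(3)[OF ge _ a(1-3) *(1)] False by simp
      ultimately show ?thesis by blast
    qed
  qed
qed

text \<open>The last part receives everything that is left, so only its predecessors have an entry in the
  list of prescribed totals.\<close>

fun fill :: "nat \<Rightarrow> nat list \<Rightarrow> nat list \<Rightarrow> nat list list list" where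
  "fill b [] xs = [[xs]]"
| "fill b (c # cs) xs =
     concat (map (\<lambda>(ys, zs). map ((#) ys) (fill (b + length xs - length ys - length zs) cs zs))
       (takes b c xs))"

text \<open>Induction on \<open>Ms\<close>: \<open>takes_complete\<close> splits off the first
  multiset, and what remains is still grouped.\<close>

lemma fill_complete:
  assumes "groups xs (sum_list Ms)" "0 \<notin># sum_list Ms" "Ms \<noteq> []"
    "size (sum_list Ms) \<le> length xs + b"
  shows "\<exists>ls \<in> set (fill b (map sum_mset (butlast Ms)) xs). list_all2 groups ls Ms"
  using assms
proof (induction Ms arbitrary: xs b)
  case (Cons A Ms)
  show ?case
  proof (cases "Ms = []")
    case True
    then show ?thesis using Cons.prems(1) by simp
  next
    case False
    have "0 \<notin># A + sum_list Ms" "size (A + sum_list Ms) \<le> length xs + b"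
      "groups xs (A + sum_list Ms)" using Cons.prems by simp_all
    from takes_complete[OF this(3,1) refl this(2)] obtain ys zs
      where *: "(ys, zs) \<in> set (takes b (\<Sum>\<^sub># A) xs)" "groups ys A" "groups zs (sum_list Ms)"
      by blast
    \<comment> \<open>Every cut adds one entry, so this is the budget left over. The size bound
      rules out truncated subtraction.\<close>
    let ?b = "b + length xs - length ys - length zs"
    have "size (sum_list Ms) \<le> length zs + ?b" "0 \<notin># sum_list Ms"
      using groups_length_le[OF *(2)] groups_length_le[OF *(3)] Cons.prems(2,4) by simp_all
    from Cons.IH[OF *(3) this(2) False this(1)] obtain ls where
      ls: "ls \<in> set (fill ?b (map sum_mset (butlast Ms)) zs)" "list_all2 groups ls Ms" by blast
    have "ys # ls \<in> set (fill b (map sum_mset (butlast (A # Ms))) xs)"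
      using False *(1) ls(1) by (auto intro!: bexI[of _ "(ys, zs)"])
    moreover have "list_all2 groups (ys # ls) (A # Ms)" using *(2) ls(2) by simp
    ultimately show ?thesis by blast
  qed
qed simp

text \<open>A state \<open>st\<close> maps the arcs of the current cut to their groupings. A vertex
  pools the entries of \<open>ins\<close> and redistributes them over \<open>outs\<close>; as at
  most \<open>n\<close> weights cross the cut, \<open>n\<close> minus the number of entries bounds
  the cuts of entries.\<close>

definition expand ::
  "nat \<Rightarrow> ('b \<Rightarrow> nat) \<Rightarrow> 'b list \<Rightarrow> 'b list \<Rightarrow> ('b \<times> nat list) list \<Rightarrow> ('b \<times> nat list) list list" where
  "expand n X ins outs st =
     (let xs = concat (map (the \<circ> map_of st) ins);
          rest = filter (\<lambda>(e, _). e \<notin> set ins) st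
      in map (\<lambda>ls. zip outs ls @ rest)
           (fill (n - length xs - length (concat (map snd rest))) (map X (butlast outs)) xs))"

fun survives ::
  "nat \<Rightarrow> ('b \<Rightarrow> nat) \<Rightarrow> ('b list \<times> 'b list) list \<Rightarrow> ('b \<times> nat list) list \<Rightarrow> bool" where
  "survives n X [] st = True"
| "survives n X ((ins, outs) # ms) st = list_ex (survives n X ms) (expand n X ins outs st)"

text \<open>Which arcs form the cut depends only on the order of the moves, so admissibility is
  checked once and not on each branch of \<open>survives\<close>.\<close>

fun sweep :: "'b list \<Rightarrow> ('b list \<times> 'b list) list \<Rightarrow> bool" where
  "sweep es [] = True"
| "sweep es ((ins, outs) # ms) =
     (distinct ins \<and> set ins \<subseteq> set es \<and> outs \<noteq> [] \<and> distinct outs \<and> set outs \<inter> set es = {} \<and>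
      sweep (outs @ filter (\<lambda>e. e \<notin> set ins) es) ms)"

text \<open>Invariant of the search, relating a state to the true weights \<open>M\<close>.\<close>

definition grouped :: "nat \<Rightarrow> ('b \<Rightarrow> nat multiset) \<Rightarrow> ('b \<times> nat list) list \<Rightarrow> bool" where
  "grouped n M st \<longleftrightarrow> distinct (map fst st) \<and> (\<forall>(e, xs) \<in> set st. groups xs (M e)) \<and>
     size (\<Sum>e\<leftarrow>map fst st. M e) \<le> n"

lemma sum_list_filter_partition:
  fixes f :: "'a \<Rightarrow> 'b :: comm_monoid_add"
  shows "sum_list (map f xs) = sum_list (map f (filter P xs)) + sum_list (map f (filter (\<lambda>x. \<not> P x) xs))"
  by (induction xs) (auto simp: ac_simps)

text \<open>By \<open>bal\<close> the pooled entries group the weights on \<open>outs\<close>, so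
  \<open>fill_complete\<close> finds a branch that is true to \<open>M\<close>. The total multiset
  on the cut is unchanged, which preserves the bound \<open>n\<close>.\<close>

lemma grouped_expand:
  assumes st: "grouped n M st"
    and step: "sweep (map fst st) ((ins, outs) # ms)"
    and bal: "(\<Sum>e\<leftarrow>ins. M e) = (\<Sum>e\<leftarrow>outs. M e)"
    and X: "\<And>e. e \<in> set outs \<Longrightarrow> \<Sum>\<^sub># (M e) = X e"
    and pos: "\<And>e. e \<in> set outs \<Longrightarrow> 0 \<notin># M e"
  shows "\<exists>st' \<in> set (expand n X ins outs st).
    grouped n M st' \<and> map fst st' = outs @ filter (\<lambda>e. e \<notin> set ins) (map fst st)"
proof -
  define rest where "rest = filter (\<lambda>(e, _). e \<notin> set ins) st"
  have rest: "map fst rest = filter (\<lambda>e. e \<notin> set ins) (map fst st)"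
    unfolding rest_def by (induction st) auto
  have dist: "distinct (map fst st)" and grp: "\<And>e xs. (e, xs) \<in> set st \<Longrightarrow> groups xs (M e)"
    and sz: "size (\<Sum>e\<leftarrow>map fst st. M e) \<le> n"
    using st by (auto simp: grouped_def)
  have ins: "distinct ins" "set ins \<subseteq> fst ` set st" and outs: "outs \<noteq> []" "distinct outs"
    "set outs \<inter> fst ` set st = {}" using step by auto
  have "mset ins = mset (filter (\<lambda>e. e \<in> set ins) (map fst st))"
    using ins dist by (intro set_eq_iff_mset_eq_distinct[THEN iffD1]) auto
  then have sum_ins: "(\<Sum>e\<leftarrow>ins. M e) = (\<Sum>e\<leftarrow>filter (\<lambda>e. e \<in> set ins) (map fst st). M e)"
    by (metis mset_map sum_mset_sum_list)
  have total: "(\<Sum>e\<leftarrow>map fst st. M e) = (\<Sum>e\<leftarrow>ins. M e) + (\<Sum>e\<leftarrow>map fst rest. M e)"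
    unfolding sum_ins rest
    by (rule sum_list_filter_partition)
  let ?items = "concat (map (the \<circ> map_of st) ins)"
  have "groups ((the \<circ> map_of st) e) (M e)" if "e \<in> set ins" for e
  proof -
    from that ins obtain xs where "(e, xs) \<in> set st" by force
    with dist grp show ?thesis by simp
  qed
  then have items: "groups ?items (\<Sum>e\<leftarrow>outs. M e)"
    using groups_concat[of ins "the \<circ> map_of st" M] bal by simp
  have all: "groups (concat (map snd xs)) (\<Sum>e\<leftarrow>map fst xs. M e)" if "set xs \<subseteq> set st" for xs
    using that grp by (induction xs) (auto intro: groups_append groups.Nil)
  \<comment> \<open>The untouched arcs carry at least one weight per entry; this limits the weights
    left for \<open>outs\<close>.\<close>
  have "length (concat (map snd rest)) \<le> size (\<Sum>e\<leftarrow>map fst rest. M e)"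
    by (rule groups_length_le[OF all]) (auto simp: rest_def)
  then have size: "size (\<Sum>e\<leftarrow>outs. M e) \<le> length ?items + (n - length ?items - length (concat (map snd rest)))"
    using sz total bal by simp
  have caps: "map sum_mset (butlast (map M outs)) = map X (butlast outs)"
    using X by (auto simp: map_butlast[symmetric] dest: in_set_butlastD)
  obtain ls where ls: "ls \<in> set (fill (n - length ?items - length (concat (map snd rest))) (map X (butlast outs)) ?items)"
    "list_all2 groups ls (map M outs)"
    using fill_complete[OF items _ _ size] pos outs caps by fastforce
  let ?st = "zip outs ls @ rest"
  have len_ls: "length ls = length outs" using ls(2) by (auto dest: list_all2_lengthD)
  then have fst: "map fst ?st = outs @ filter (\<lambda>e. e \<notin> set ins) (map fst st)" using rest by simp
  have "groups xs (M e)" if "(e, xs) \<in> set (zip outs ls)" for e xs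
    using that ls(2) by (auto simp: in_set_zip list_all2_conv_all_nth)
  then have "\<forall>(e, xs) \<in> set ?st. groups xs (M e)" using grp by (auto simp: rest_def)
  moreover have "distinct (map fst ?st)" unfolding fst using outs dist by auto
  moreover have "(\<Sum>e\<leftarrow>map fst ?st. M e) = (\<Sum>e\<leftarrow>map fst st. M e)"
    unfolding fst total bal rest by simp
  ultimately have "grouped n M ?st" using sz unfolding grouped_def by simp
  moreover have "?st \<in> set (expand n X ins outs st)"
    unfolding expand_def Let_def rest_def[symmetric] set_map using ls(1) by (rule imageI)
  ultimately show ?thesis using fst by blast
qed

text \<open>At each move some branch follows the true weights. Hence a failed search refutes every
  such \<open>M\<close>.\<close>

lemma survives_complete:
  assumes "grouped n M st" "sweep (map fst st) ms"
    "\<And>ins outs. (ins, outs) \<in> set ms \<Longrightarrow> (\<Sum>e\<leftarrow>ins. M e) = (\<Sum>e\<leftarrow>outs. M e)"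
    "\<And>ins outs e. (ins, outs) \<in> set ms \<Longrightarrow> e \<in> set outs \<Longrightarrow> \<Sum>\<^sub># (M e) = X e \<and> 0 \<notin># M e"
  shows "survives n X ms st"
  using assms
proof (induction ms arbitrary: st)
  case (Cons m ms)
  obtain ins outs where m: "m = (ins, outs)" by (cases m)
  have "(ins, outs) \<in> set (m # ms)" by (simp add: m)
  note * = Cons.prems(3)[OF this] Cons.prems(4)[OF this]
  have "sweep (map fst st) ((ins, outs) # ms)" using Cons.prems(2) by (simp only: m)
  from grouped_expand[where X = X, OF Cons.prems(1) this *(1)] *(2)
  obtain st' where st': "st' \<in> set (expand n X ins outs st)" "grouped n M st'"
    "map fst st' = outs @ filter (\<lambda>e. e \<notin> set ins) (map fst st)"
    by blast
  have "sweep (map fst st') ms" using Cons.prems(2) unfolding m st'(3) by simp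
  then have "survives n X ms st'"
    by (rule Cons.IH[OF st'(2)]) (erule Cons.prems(3,4)[OF list.set_intros(2)], assumption?)+
  with st'(1) show ?case unfolding m survives.simps list_ex_iff by blast
qed simp

section \<open>The weights on the arcs of a decomposed flow\<close>

text \<open>Induction along the walk: it enters and leaves a vertex equally often, up to the end
  points counted by \<open>of_bool\<close>.\<close>

lemma (in pre_digraph) cas_balance:
  "cas u p v \<Longrightarrow>
   length (filter (\<lambda>e. tail G e = x) p) + of_bool (x = v) =
   length (filter (\<lambda>e. head G e = x) p) + of_bool (x = u)"
  by (induction u p v rule: cas.induct) auto

text \<open>Zero weights are dropped, since the search needs nonempty parts to have positive
  sums.\<close>

definition weights_on :: "'b awalk list \<Rightarrow> nat list \<Rightarrow> 'b \<Rightarrow> nat multiset" where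
  "weights_on Ps ws e =
     (\<Sum>j<length Ps. if e \<in> set (Ps ! j) then (if ws ! j = 0 then {#} else {#ws ! j#}) else {#})"

lemma sum_mset_sum: "\<Sum>\<^sub># (sum f A) = (\<Sum>x\<in>A. \<Sum>\<^sub># (f x))"
  by (induction A rule: infinite_finite_induct) auto

lemma size_sum: "size (sum f A :: 'c multiset) = (\<Sum>x\<in>A. size (f x))"
  by (induction A rule: infinite_finite_induct) auto

lemma zero_notin_weights_on: "0 \<notin># weights_on Ps ws e"
  by (auto simp: weights_on_def set_mset_sum split: if_splits)

lemma sum_weights_on:
  "\<Sum>\<^sub># (weights_on Ps ws e) = (\<Sum>j<length Ps. ws ! j * path_flow (Ps ! j) e)"
  by (auto simp: weights_on_def sum_mset_sum path_flow_def intro!: sum.cong)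

text \<open>The replicated list expresses a multiple of \<open>c\<close> in a monoid;
  \<open>f\<close> will be \<open>head\<close> or \<open>tail\<close>, and \<open>c\<close> a
  multiset.\<close>

lemma sum_if_in_walk:
  fixes c :: "'c :: comm_monoid_add"
  assumes "finite A" "distinct p" "set p \<subseteq> A"
  shows "(\<Sum>e | e \<in> A \<and> f e = x. if e \<in> set p then c else 0) =
    sum_list (replicate (length (filter (\<lambda>e. f e = x) p)) c)"
proof -
  have "(\<Sum>e | e \<in> A \<and> f e = x. if e \<in> set p then c else 0) =
      (\<Sum>e \<in> {e \<in> A. f e = x} \<inter> set p. c)"
    using assms(1) by (simp add: sum.inter_restrict)
  also have "{e \<in> A. f e = x} \<inter> set p = set (filter (\<lambda>e. f e = x) p)"
    using assms(3) by auto
  also have "(\<Sum>e \<in> \<dots>. c) = sum_list (map (\<lambda>_. c) (filter (\<lambda>e. f e = x) p))"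
    using assms(2) by (intro sum.distinct_set_conv_list) simp
  finally show ?thesis by (simp add: map_replicate_const)
qed

context fin_digraph
begin

text \<open>Exchange the sums over arcs and paths; the arcs of an \<open>apath\<close> are
  distinct.\<close>

lemma sum_weights_on_arcs:
  assumes "\<forall>p \<in> set Ps. apath s p t"
  shows "(\<Sum>e\<in>in_arcs G x. weights_on Ps ws e) = (\<Sum>j<length Ps. sum_list (replicate
      (length (filter (\<lambda>e. head G e = x) (Ps ! j))) (if ws ! j = 0 then {#} else {#ws ! j#})))"
    and "(\<Sum>e\<in>out_arcs G x. weights_on Ps ws e) = (\<Sum>j<length Ps. sum_list (replicate
      (length (filter (\<lambda>e. tail G e = x) (Ps ! j))) (if ws ! j = 0 then {#} else {#ws ! j#})))"
proof -
  have "distinct p" "set p \<subseteq> arcs G" if "p \<in> set Ps" for p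
    using assms that distinct_verts_imp_distinct by (auto simp: apath_def awalk_def)
  then have "(\<Sum>e | e \<in> arcs G \<and> f e = x. weights_on Ps ws e) = (\<Sum>j<length Ps. sum_list (replicate
      (length (filter (\<lambda>e. f e = x) (Ps ! j))) (if ws ! j = 0 then {#} else {#ws ! j#})))"
    for f unfolding weights_on_def
    by (subst sum.swap) (intro sum.cong refl sum_if_in_walk; simp)
  then show "(\<Sum>e\<in>in_arcs G x. weights_on Ps ws e) = (\<Sum>j<length Ps. sum_list (replicate
      (length (filter (\<lambda>e. head G e = x) (Ps ! j))) (if ws ! j = 0 then {#} else {#ws ! j#})))"
    and "(\<Sum>e\<in>out_arcs G x. weights_on Ps ws e) = (\<Sum>j<length Ps. sum_list (replicate
      (length (filter (\<lambda>e. tail G e = x) (Ps ! j))) (if ws ! j = 0 then {#} else {#ws ! j#})))"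
    by (simp_all add: in_arcs_def out_arcs_def)
qed

text \<open>Conservation holds for the multisets of weights themselves, because every single path is
  balanced at \<open>x\<close>.\<close>

lemma weights_on_balance:
  assumes Ps: "\<forall>p \<in> set Ps. apath s p t" and "x \<noteq> s" "x \<noteq> t"
  shows "(\<Sum>e\<in>in_arcs G x. weights_on Ps ws e) = (\<Sum>e\<in>out_arcs G x. weights_on Ps ws e)"
proof -
  have "length (filter (\<lambda>e. head G e = x) p) = length (filter (\<lambda>e. tail G e = x) p)"
    if "p \<in> set Ps" for p
    using cas_balance[of s p t x] that assms by (auto simp: apath_def awalk_def)
  then show ?thesis by (simp add: sum_weights_on_arcs[OF Ps])
qed

text \<open>No path can return to \<open>s\<close>, so each leaves it exactly once and contributes
  at most one weight.\<close>

lemma size_weights_on_source: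
  assumes Ps: "\<forall>p \<in> set Ps. apath s p t" and "s \<noteq> t" "in_arcs G s = {}"
  shows "size (\<Sum>e\<in>out_arcs G s. weights_on Ps ws e) \<le> length Ps"
proof -
  have "length (filter (\<lambda>e. tail G e = s) p) = 1" if "p \<in> set Ps" for p
  proof -
    have "filter (\<lambda>e. head G e = s) p = []"
      using that assms by (fastforce simp: apath_def awalk_def filter_empty_conv)
    then show ?thesis
      using cas_balance[of s p t s] that assms by (simp add: apath_def awalk_def)
  qed
  then have "size (\<Sum>e\<in>out_arcs G s. weights_on Ps ws e) =
      (\<Sum>j<length Ps. size (if ws ! j = 0 then {#} else {#ws ! j#}))"
    by (simp add: sum_weights_on_arcs[OF Ps] size_sum)
  also have "\<dots> \<le> (\<Sum>j<length Ps. 1)" by (rule sum_mono) simp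
  finally show ?thesis by simp
qed

lemma survives_if_flow_decomposition:
  assumes dec: "flow_decomposition G s t X Ps ws" and n: "length Ps \<le> n"
    and s: "s \<noteq> t" "in_arcs G s = {}" "\<And>e. e \<in> out_arcs G s \<Longrightarrow> X e \<noteq> 0"
    and es: "distinct es" "set es = arcs G"
    and vs: "s \<notin> set vs" "t \<notin> set vs"
    and ms: "ms = map (\<lambda>v. (filter (\<lambda>e. head G e = v) es, filter (\<lambda>e. tail G e = v) es)) vs"
    and sweep: "sweep (filter (\<lambda>e. tail G e = s) es) ms"
  shows "survives n X ms (map (\<lambda>e. (e, [X e])) (filter (\<lambda>e. tail G e = s) es))"
proof (rule survives_complete)
  let ?M = "weights_on Ps ws"
  have Ps: "\<forall>p \<in> set Ps. apath s p t"
    and X: "\<And>e. e \<in> arcs G \<Longrightarrow> \<Sum>\<^sub># (?M e) = X e"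
    using dec by (auto simp: flow_decomposition_def solves_system_def sum_weights_on)
  have ins: "(\<Sum>e\<leftarrow>filter (\<lambda>e. head G e = v) es. ?M e) = (\<Sum>e\<in>in_arcs G v. ?M e)"
    and outs: "(\<Sum>e\<leftarrow>filter (\<lambda>e. tail G e = v) es. ?M e) = (\<Sum>e\<in>out_arcs G v. ?M e)" for v
    using es by (simp_all add: sum.distinct_set_conv_list[symmetric] in_arcs_def out_arcs_def)
  \<comment> \<open>The search starts from the coarsest grouping, one part per arc. That part is
    nonempty because the flow on the arc is nonzero.\<close>
  have "groups [X e] (?M e)" if "e \<in> out_arcs G s" for e
    using that X[of e] s(3)[of e] groups_singleton[of "?M e"] by simp
  moreover have "size (\<Sum>e\<in>out_arcs G s. ?M e) \<le> n"
    using size_weights_on_source[OF Ps s(1,2)] n by (rule order_trans)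
  ultimately show "grouped n ?M (map (\<lambda>e. (e, [X e])) (filter (\<lambda>e. tail G e = s) es))"
    using es outs[of s] by (auto simp: grouped_def comp_def)
  show "sweep (map fst (map (\<lambda>e. (e, [X e])) (filter (\<lambda>e. tail G e = s) es))) ms"
    using sweep by (simp add: comp_def)
  show "(\<Sum>e\<leftarrow>ins. ?M e) = (\<Sum>e\<leftarrow>outs. ?M e)" if "(ins, outs) \<in> set ms" for ins outs
    using that vs by (auto simp: ms ins outs intro!: weights_on_balance[OF Ps])
  show "\<Sum>\<^sub># (?M e) = X e \<and> 0 \<notin># ?M e" if "(ins, outs) \<in> set ms" "e \<in> set outs" for ins outs e
    using that X es by (auto simp: ms zero_notin_weights_on)
qed

end

section \<open>Rank of the path matrix\<close>

text \<open>The rank is the size of a maximal independent set \<open>S\<close> of columns. Distinct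
  columns are dependent by \<open>v\<close>, so \<open>S\<close> omits one; repeated columns already
  form a set of fewer than \<open>nc\<close> vectors.\<close>

lemma rank_less_if_kernel:
  fixes A :: "'a :: field mat"
  assumes A: "A \<in> carrier_mat n nc" and v: "v \<in> carrier_vec nc" "v \<noteq> 0\<^sub>v nc" "A *\<^sub>v v = 0\<^sub>v n"
  shows "vec_space.rank n A < nc"
proof -
  interpret vec_space "TYPE('a)" n .
  obtain S where S: "maximal S (\<lambda>T. T \<subseteq> set (cols A) \<and> lin_indpt T)"
    using maximal_exists_superset[of "set (cols A)" "\<lambda>T. T \<subseteq> set (cols A) \<and> lin_indpt T" "{}"]
      finite_lin_indpt2[of "{}"] by auto
  then have sub: "S \<subseteq> set (cols A)" "lin_indpt S" by (auto simp: maximal_def)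
  have nc: "length (cols A) = nc" using A by simp
  have "card S < nc"
  proof (cases "distinct (cols A)")
    case True
    then have "S \<noteq> set (cols A)" using lin_depI[OF A v] sub(2) by blast
    then have "card S < card (set (cols A))" using sub(1) by (intro psubset_card_mono) auto
    then show ?thesis using card_length[of "cols A"] nc by linarith
  next
    case False
    then have "card (set (cols A)) < nc" using card_distinct[of "cols A"] card_length[of "cols A"] nc by force
    then show ?thesis using card_mono[OF _ sub(1)] by force
  qed
  then show ?thesis using rank_card_indpt[OF A S] by simp
qed

text \<open>The difference of the two solutions, taken over the reals, is a nonzero kernel
  vector.\<close>

lemma rank_path_matrix_less:
  assumes w: "solves_system G X Ps w" and w': "solves_system G X Ps w'" and "w \<noteq> w'"
    and es: "distinct es" "set es = arcs G"
  shows "vec_space.rank (card (arcs G)) (path_matrix es Ps) < length Ps"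
proof (rule rank_less_if_kernel)
  let ?n = "card (arcs G)" and ?v = "vec (length Ps) (\<lambda>j. real (w ! j) - real (w' ! j))"
  have n: "length es = ?n" using distinct_card[OF es(1)] es(2) by simp
  show "path_matrix es Ps \<in> carrier_mat ?n (length Ps)" by (simp add: path_matrix_def n)
  show "?v \<in> carrier_vec (length Ps)" by simp
  have len: "length w = length Ps" "length w' = length Ps"
    using w w' by (auto simp: solves_system_def)
  with \<open>w \<noteq> w'\<close> obtain j where "j < length Ps" "w ! j \<noteq> w' ! j"
    by (metis nth_equalityI)
  then have "?v $ j \<noteq> 0\<^sub>v (length Ps) $ j" by simp
  then show "?v \<noteq> 0\<^sub>v (length Ps)" by metis
  show "path_matrix es Ps *\<^sub>v ?v = 0\<^sub>v ?n"
  proof (rule eq_vecI)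
    fix i assume "i < dim_vec (0\<^sub>v ?n :: real vec)"
    then have i: "i < ?n" by simp
    then have e: "es ! i \<in> arcs G" using n es(2) nth_mem by metis
    have "(path_matrix es Ps *\<^sub>v ?v) $ i =
        (\<Sum>j<length Ps. real (path_flow (Ps ! j) (es ! i)) * (real (w ! j) - real (w' ! j)))"
      using i n by (auto simp: path_matrix_def scalar_prod_def path_flow_def
          lessThan_atLeast0 intro!: sum.cong)
    also have "\<dots> = real (\<Sum>j<length Ps. w ! j * path_flow (Ps ! j) (es ! i)) -
        real (\<Sum>j<length Ps. w' ! j * path_flow (Ps ! j) (es ! i))"
      by (simp add: right_diff_distrib sum_subtractf mult.commute)
    also have "\<dots> = 0" using e w w' by (auto simp: solves_system_def)
    finally show "(path_matrix es Ps *\<^sub>v ?v) $ i = 0\<^sub>v ?n $ i" using i by simp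
  qed (simp add: path_matrix_def n)
qed

section \<open>The counterexample\<close>

text \<open>Vertices are numbered topologically, with source 0 and sink 15.\<close>

definition tails :: "nat list" where
  "tails = [0, 0, 0, 1, 0, 2, 2, 3, 3, 4, 4, 5, 5, 6, 7, 7, 8, 9, 9, 10, 9, 11, 12, 12, 13, 12, 14]"

definition heads :: "nat list" where
  "heads = [7, 2, 1, 2, 3, 3, 4, 4, 5, 5, 9, 7, 6, 7, 9, 8, 9, 12, 10, 12, 11, 12, 15, 13, 15, 14, 15]"

definition flow_values :: "nat list" where
  "flow_values = [4, 3, 13, 13, 19, 6, 10, 13, 12, 3, 20, 6, 9, 9, 8, 11, 11, 18, 3,
    3, 18, 18, 15, 12, 12, 12, 12]"

definition G0 :: "(nat, nat) pre_digraph" where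
  "G0 = \<lparr>verts = {..<16}, arcs = {..<27}, tail = (!) tails, head = (!) heads\<rparr>"

text \<open>The arcs crossed by the \<open>j\<close>-th path are those on which \<open>j\<close> is listed here:
  \<open>07, 15, 26, 26, 34, 16, 25, 14, 36, 15, 24, 16, 35, 35, 056, 137, 137, 046, 15, 15, 237, 237,
  045, 127, 127, 36, 36\<close>. Each of these sets has sum zero with respect to
  \<open>d = (-2, -1, -1, -1, 1, 1, 1, 2)\<close>. Vertices 1, 6, 8, 10, 11, 13, 14 only subdivide parallel arcs.\<close>

definition paths :: "nat awalk list" where
  "paths =
    [[0, 14, 17, 22],
     [1, 5, 7, 9, 11, 15, 16, 18, 19, 23, 24],
     [2, 3, 6, 10, 20, 21, 23, 24],
     [4, 8, 12, 13, 15, 16, 20, 21, 25, 26],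
     [4, 7, 10, 17, 22],
     [1, 6, 9, 12, 13, 14, 18, 19, 22],
     [2, 3, 5, 8, 11, 14, 17, 25, 26],
     [0, 15, 16, 20, 21, 23, 24]]"

lemma G0_simps [simp]:
  "verts G0 = {..<16}" "arcs G0 = {..<27}" "tail G0 = (!) tails" "head G0 = (!) heads"
  by (simp_all add: G0_def)

text \<open>Finite checks for \<open>st_dag\<close>: increasing arcs exclude cycles and loops,
  distinct ends exclude parallel arcs, and the two ranges single out source and sink.\<close>

lemma tail_less_head: "\<forall>e \<in> {..<27}. tails ! e < heads ! e"
  and heads_less: "\<forall>e \<in> {..<27}. heads ! e < 16"
  and distinct_ends: "distinct (zip tails heads)"
  and tails_set: "set tails = {..<15}"
  and heads_set: "set heads = {1..<16}"
  and length_tails: "length tails = 27" "length heads = 27"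
  by code_simp+

text \<open>The second weighting is the first plus \<open>d\<close>.\<close>

lemma solves: "solves_system G0 ((!) flow_values) paths [3, 2, 9, 8, 11, 1, 4, 1]"
  "solves_system G0 ((!) flow_values) paths [1, 1, 8, 7, 12, 2, 5, 3]"
  unfolding solves_system_def G0_simps by code_simp+

section \<open>Validity of the paths, the graph and the flow\<close>

lemma paths_apath: "\<forall>p \<in> set paths. pre_digraph.apath G0 0 p 15"
proof -
  have "\<forall>p \<in> set paths. set p \<subseteq> set [0..<27]" 
   "\<forall>p \<in> set paths. distinct (pre_digraph.awalk_verts G0 0 p)"
   "\<forall>p \<in> set paths. pre_digraph.cas G0 0 p 15"
    by (simp_all add: paths_def pre_digraph.awalk_verts.simps pre_digraph.cas.simps tails_def heads_def)
  then show ?thesis by (auto simp: pre_digraph.apath_def pre_digraph.awalk_def subset_iff)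
qed

lemma digraph_G0: "digraph G0"
proof
  show "tail G0 e \<in> verts G0" if "e \<in> arcs G0" for e
    using that bspec[OF tail_less_head, of e] bspec[OF heads_less, of e] by simp
  show "head G0 e \<in> verts G0" if "e \<in> arcs G0" for e
    using that heads_less by simp
  show "tail G0 e \<noteq> head G0 e" if "e \<in> arcs G0" for e
    using that bspec[OF tail_less_head, of e] by simp
  show "e1 = e2" if "e1 \<in> arcs G0" "e2 \<in> arcs G0" "arc_to_ends G0 e1 = arc_to_ends G0 e2" for e1 e2
    using that nth_eq_iff_index_eq[OF distinct_ends, of e1 e2]
    by (simp add: arc_to_ends_def length_tails)
qed simp_all

lemma st_dag_G0: "st_dag G0 0 15"
  unfolding st_dag_def
proof (intro conjI)
  show "acyclic (arcs_ends G0)"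
    by (rule acyclic_subset[OF wf_acyclic[OF wf_less]])
       (use tail_less_head in \<open>auto simp: arcs_ends_conv\<close>)
  have "out_arcs G0 v \<noteq> {} \<longleftrightarrow> v \<in> {..<15}" "in_arcs G0 v \<noteq> {} \<longleftrightarrow> v \<in> {1..<16}" for v
    unfolding tails_set[symmetric] heads_set[symmetric]
    by (auto simp: in_set_conv_nth out_arcs_def in_arcs_def length_tails)
  then have "out_arcs G0 v = {} \<longleftrightarrow> 15 \<le> v" "in_arcs G0 v = {} \<longleftrightarrow> v = 0 \<or> 16 \<le> v" for v
    by (metis One_nat_def Suc_leI atLeastLessThan_iff lessThan_iff not_less gr0I not_one_le_zero)+
  then show "{v \<in> verts G0. in_arcs G0 v = {}} = {0}" "{v \<in> verts G0. out_arcs G0 v = {}} = {15}"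
    by auto
qed (rule digraph_G0)

lemma is_flow_G0: "is_flow G0 0 15 ((!) flow_values)"
proof -
  have arcs: "{..<27} = set [0..<27::nat]" by auto
  \<comment> \<open>Sums over filtered lists make conservation executable.\<close>
  have "\<forall>v \<in> {1..<15}. (\<Sum>e\<leftarrow>filter (\<lambda>e. heads ! e = v) [0..<27]. flow_values ! e) =
      (\<Sum>e\<leftarrow>filter (\<lambda>e. tails ! e = v) [0..<27]. flow_values ! e)"
    by code_simp
  moreover have "v \<in> {1..<15}" if "v \<in> verts G0 - {0, 15}" for v using that by auto
  ultimately show ?thesis
    by (simp add: is_flow_def in_arcs_def out_arcs_def arcs set_filter[symmetric]
        sum.distinct_set_conv_list del: set_filter set_upt)
qed

section \<open>Lower bound: seven paths do not suffice\<close>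

definition moves :: "(nat list \<times> nat list) list" where
  "moves = map (\<lambda>v. (filter (\<lambda>e. heads ! e = v) [0..<27], filter (\<lambda>e. tails ! e = v) [0..<27])) [1..<13]"

text \<open>Increasing order is topological, so all in-arcs of a vertex lie in the cut when its turn
  comes.\<close>

lemma sweep_moves: "sweep (filter (\<lambda>e. tails ! e = 0) [0..<27]) moves"
  by code_simp

text \<open>The search is already exhausted after vertex 12.\<close>

lemma not_survives_moves:
  "\<not> survives 7 ((!) flow_values) moves
     (map (\<lambda>e. (e, [flow_values ! e])) (filter (\<lambda>e. tails ! e = 0) [0..<27]))"
  by code_simp

text \<open>The search bounds the number of paths by 7 only from above, so one computation excludes
  all smaller sizes as well.\<close>

lemma eight_paths_needed:
  assumes "flow_decomposition G0 0 15 ((!) flow_values) Ps ws"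
  shows "8 \<le> length Ps"
proof (rule ccontr)
  assume "\<not> 8 \<le> length Ps"
  then have n: "length Ps \<le> 7" by simp
  interpret digraph G0 by (rule digraph_G0)
  have in0: "in_arcs G0 0 = {}" using st_dag_G0 by (auto simp: st_dag_def)
  have "\<forall>e \<in> {..<27}. flow_values ! e \<noteq> 0" by code_simp
  then have X: "flow_values ! e \<noteq> 0" if "e \<in> out_arcs G0 0" for e using that by simp
  have es: "distinct [0..<27]" "set [0..<27] = arcs G0" by auto
  have "survives 7 ((!) flow_values) moves
     (map (\<lambda>e. (e, [flow_values ! e])) (filter (\<lambda>e. tail G0 e = 0) [0..<27]))"
    by (rule survives_if_flow_decomposition[OF assms n _ in0 X es, of "[1..<13]"])
       (use sweep_moves in \<open>auto simp: moves_def\<close>)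
  then show False using not_survives_moves by simp
qed

section \<open>The minimum size and the final statement\<close>

lemma mfd_nat_G0: "mfd_nat G0 0 15 ((!) flow_values) = 8"
  unfolding mfd_nat_def
proof (rule Least_equality)
  have "length paths = 8" by (simp add: paths_def)
  then show "\<exists>Ps ws. length Ps = 8 \<and> flow_decomposition G0 0 15 ((!) flow_values) Ps ws"
    using solves(1) paths_apath by (auto simp: flow_decomposition_def)
qed (use eight_paths_needed in auto)

theorem mainTheorem5:
  shows "\<exists>(G :: (nat, nat) pre_digraph) s t (X :: nat \<Rightarrow> nat) (Ps :: nat awalk list).
    st_dag G s t \<and> is_flow G s t X \<and>
    (\<exists>ws. minimum_flow_decomposition G s t X Ps ws) \<and>
    (\<exists>w w'. solves_system G X Ps w \<and> solves_system G X Ps w' \<and> w \<noteq> w') \<and>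
    (\<forall>es. distinct es \<and> set es = arcs G \<longrightarrow>
       vec_space.rank (card (arcs G)) (path_matrix es Ps) < length Ps)"
proof (intro exI conjI allI impI)
  show "st_dag G0 0 15" by (rule st_dag_G0)
  show "is_flow G0 0 15 ((!) flow_values)" by (rule is_flow_G0)
  show "minimum_flow_decomposition G0 0 15 ((!) flow_values) paths [3, 2, 9, 8, 11, 1, 4, 1]"
    using solves(1) paths_apath
    by (simp add: minimum_flow_decomposition_def flow_decomposition_def mfd_nat_G0 paths_def)
  show "solves_system G0 ((!) flow_values) paths [3, 2, 9, 8, 11, 1, 4, 1]"
    "solves_system G0 ((!) flow_values) paths [1, 1, 8, 7, 12, 2, 5, 3]" by (rule solves)+
  show neq: "[3, 2, 9, 8, 11, 1, 4, 1] \<noteq> [1, 1, 8, 7, 12, 2, 5, 3 :: nat]" by simp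
  show "vec_space.rank (card (arcs G0)) (path_matrix es paths) < length paths"
    if "distinct es \<and> set es = arcs G0" for es
    using rank_path_matrix_less[OF solves neq] that by blast
qed

end
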